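(* Let $s\ge0$ be an even integer, let $\Theta_1,\dots,\Theta_n$ be i.i.d. circular random variables with density $f$, let $(L_\rho)$ be a circular kernel family, let $(\rho_n)$ be a sequence of smoothing parameters, write $\mathfrak h_n=h_L(\rho_n)$, and let $$\hat\psi_{s;\rho}=\frac1{n^2}\sum_{i=1}^n\sum_{j=1}^nL_\rho^{(s)}(\Theta_i-\Theta_j)$$ be the estimator of $\psi_s=\int_{-\pi}^{\pi}f^{(s)}(\theta)f(\theta)\,d\theta$. Assume $\psi_{s+2}\neq0$ and: (A1) $f^{(s+2)}$ is continuous and square-integrable on $[-\pi,\pi)$. (A2) $L$ is a bounded circular density, reflectively symmetric about zero, unimodal, and its $s$-th derivative is square-integrable on $[-\pi,\pi)$. (A3) As $n\to\infty$: $\mathfrak h_n\to0$, $R_{L;s,2}(\rho_n)\to\infty$ and $n^{-1}R_{L;s,2}(\rho_n)\to0$. (A4) As $n\to\infty$: $|R_{L;s,1}(\rho_n)|\to\infty$ and $n^{-1}R_{L;s,1}(\rho_n)\to0$. (E1) $\int_{-\pi}^{\pi}\theta^4L_{\rho_n}(\theta)\,d\theta=o(\mathfrak h_n)$. (E2) $\int_{-\pi}^{\pi}\theta^2\big(L^{(s)}_{\rho_n}(\theta)\big)^2d\theta=o\big(R_{L;s,2}(\rho_n)\big)$. (E3) As $n$ increases, $R_{L;s,2}(\rho_n)=Q_{L;s,2}\,\mathfrak h_n^{-(2s+1)/2}$ (asymptotically), with $Q_{L;s,2}$ a constant depending only on $L$ and $s$. (E4) As $n$ increases, $R_{L;s,1}(\rho_n)=Q_{L;s,1}\,\mathfrak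 h_n^{-(s+1)/2}$ (asymptotically), with $Q_{L;s,1}$ a constant depending only on $L$ and $s$, whose sign equals the sign of $(-1)^{s/2}$. Then, asymptotically, the AMSE-optimal value of $\mathfrak h_n$ for $\hat\psi_{s;\rho}$ is $$\mathfrak h_{L;s;\mathrm{AMSE}}=\left(-\frac{2Q_{L;s,1}}{n\,\psi_{s+2}}\right)^{2/(s+3)}.$$ If, in addition, (E5) $\int_{-\pi}^{\pi}\theta^4L_{\rho_n}(\theta)\,d\theta=o(\mathfrak h_n^{5/4})$, then the minimal AMSE of $\hat\psi_{s;\rho}$ is of order $O\big(n^{-\min(5,s+3)/(s+3)}\big)$. More precisely, to leading order as $n\to\infty$, with $$T_1=2\psi_0Q_{L;s,2}\left(-\frac{\psi_{s+2}}{2Q_{L;s,1}}\right)^{(2s+1)/(s+3)}n^{-5/(s+3)},\qquad T_2=4\left(\int_{-\pi}^{\pi}\big(f^{(s)}(\theta)\big)^2f(\theta)\,d\theta-\psi_s^2\right)n^{-1},$$ one has $\inf_{0\le\rho<1}\mathrm{AMSE}[\hat\psi_{s;\rho}]=T_1$ if $s>2$ (even), $=T_2$ if $s=0$, and $=T_1+T_2$ if $s=2$.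
   Context: Circular densities are regarded as $2\pi$-periodic functions on the real line (so continuity and derivatives are understood on the circle) that integrate to one over $[-\pi,\pi)$. For every even $k\ge0$ used, $\psi_k=\int_{-\pi}^{\pi}f^{(k)}(\theta)f(\theta)\,d\theta$; by integration by parts $\psi_{2m}=(-1)^m\int_{-\pi}^{\pi}(f^{(m)})^2$. A circular kernel family $L_\rho$ is a family of circular densities, symmetric about zero, unimodal and square-integrable, indexed by the smoothing parameter $\rho\in[0,1]$ (the mean resultant length), with convergent Fourier series $$L_\rho(\theta)=\frac1{2\pi}\Big(1+2\sum_{j=1}^\infty\alpha_{L,j}(\rho)\cos(j\theta)\Big),\qquad \alpha_{L,j}(\rho)\in[0,1].$$ Define $h_L(\rho)=\frac{\pi^2}{3}+4\sum_{j=1}^\infty\frac{(-1)^j\alpha_{L,j}(\rho)}{j^2}$ and, for $t\in\{1,2\}$ and even $s$, $$R_{L;0,t}(\rho)=\frac1{2\pi}\Big(1+2\sum_{j=1}^\infty\alpha_{L,j}^t(\rho)\Big),\qquad R_{L;s,t}(\rho)=\frac{\mathfrak s}{\pi}\sum_{j=1}^\infty j^{ts}\alpha_{L,j}^t(\rho)\quad(s\ge2),$$ where $\mathfrak s=-1$ if $t=1$ and $s\equiv2\pmod 4$, and $\mathfrak s=1$ otherwise. $\mathrm{AMSE}$ is the asymptotic leading part (squared leading bias plus leading variance) of $\mathbb E[(\hat\psi_{s;\rho_n}-\psi_s)^2]$; under (A1)–(A4), (E1), (E2) it is $$\Big(n^{-1}R_{L;s,1}(\rho_n)+\tfrac12h_L(\rho_n)\psi_{s+2}\Big)^2+2n^{-2}\psi_0R_{L;s,2}(\rho_n)+4n^{-1}\Big(\int_{-\pi}^{\pi}(f^{(s)})^2f-\psi_s^2\Big).$$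 In the corollary, $R_{L;s,1}$ and $R_{L;s,2}$ in this expression are replaced by their asymptotic forms in (E3), (E4) (asymptotic equality means the ratio of both sides tends to $1$), so AMSE becomes a function of $\mathfrak h=h_L(\rho)>0$; "optimal" and "$\inf_{0\le\rho<1}$" refer to minimizing this function over $\mathfrak h>0$. "Asymptotically optimal value" means that the ratio of a minimizer to $\mathfrak h_{L;s;\mathrm{AMSE}}$ tends to $1$ as $n\to\infty$, and "to leading order" means that the ratio of the two sides tends to $1$. *)

theory Defs
  imports "HOL-Probability.Probability" "HOL-Library.Landau_Symbols"
begin

text \<open>
  Functions on the circle are \<open>2 * pi\<close>-periodic functions on the real line; all integrals are
  taken over the period \<open>[-pi, pi)\<close>.
\<close>

definition circ_int :: "(real \<Rightarrow> real) \<Rightarrow> real" where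
  "circ_int g = (LINT \<theta>:{-pi..<pi}|lborel. g \<theta>)"

definition circ_square_integrable :: "(real \<Rightarrow> real) \<Rightarrow> bool" where
  "circ_square_integrable g \<longleftrightarrow>
     set_borel_measurable lborel {-pi..<pi} g \<and>
     set_integrable lborel {-pi..<pi} (\<lambda>\<theta>. (g \<theta>)\<^sup>2)"

text \<open>Integrability need not be required separately: a non-integrable function has integral \<open>0\<close>.\<close>

definition circular_density :: "(real \<Rightarrow> real) \<Rightarrow> bool" where
  "circular_density g \<longleftrightarrow>
     g \<in> borel_measurable borel \<and> (\<forall>\<theta>. 0 \<le> g \<theta>) \<and>
     (\<forall>\<theta>. g (\<theta> + 2 * pi) = g \<theta>) \<and> circ_int g = 1"

definition times_differentiable :: "nat \<Rightarrow> (real \<Rightarrow> real) \<Rightarrow> bool" where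
  "times_differentiable k g \<longleftrightarrow> (\<forall>i<k. \<forall>x. (deriv ^^ i) g differentiable (at x))"

text \<open>Unimodality on the circle, with antimode \<open>a\<close> and mode \<open>m\<close>; plateaus are allowed, so that
  the uniform density (the member \<open>\<rho> = 0\<close> of a kernel family) is unimodal.\<close>

definition circ_unimodal :: "(real \<Rightarrow> real) \<Rightarrow> bool" where
  "circ_unimodal g \<longleftrightarrow>
     (\<exists>a m. a \<le> m \<and> m \<le> a + 2 * pi \<and> mono_on {a..m} g \<and> antimono_on {m..a + 2 * pi} g)"

definition mean_resultant_length :: "(real \<Rightarrow> real) \<Rightarrow> real" where
  "mean_resultant_length g =
     sqrt ((circ_int (\<lambda>\<theta>. cos \<theta> * g \<theta>))\<^sup>2 + (circ_int (\<lambda>\<theta>. sin \<theta> * g \<theta>))\<^sup>2)"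

text \<open>\<open>psi f k\<close> is the functional \<open>\<psi>\<^sub>k\<close> of the density \<open>f\<close>.\<close>

definition psi :: "(real \<Rightarrow> real) \<Rightarrow> nat \<Rightarrow> real" where
  "psi f k = circ_int (\<lambda>\<theta>. (deriv ^^ k) f \<theta> * f \<theta>)"

text \<open>A kernel family is a function \<open>L\<close> with \<open>L \<rho>\<close> the kernel \<open>L\<^sub>\<rho>\<close>. Its Fourier coefficients
  \<open>\<alpha>\<^sub>L\<^sub>,\<^sub>j(\<rho>)\<close> are the cosine moments.\<close>

definition alpha :: "(real \<Rightarrow> real \<Rightarrow> real) \<Rightarrow> nat \<Rightarrow> real \<Rightarrow> real" where
  "alpha L j \<rho> = circ_int (\<lambda>\<theta>. cos (real j * \<theta>) * L \<rho> \<theta>)"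

text \<open>The endpoint \<open>\<rho> = 1\<close> is left unconstrained: mean resultant length one characterises point
  masses, so there is no density \<open>L 1\<close>.\<close>

definition circular_kernel_family :: "(real \<Rightarrow> real \<Rightarrow> real) \<Rightarrow> bool" where
  "circular_kernel_family L \<longleftrightarrow> (\<forall>\<rho>\<in>{0..<1}.
     circular_density (L \<rho>) \<and> (\<forall>\<theta>. L \<rho> (-\<theta>) = L \<rho> \<theta>) \<and>
     circ_unimodal (L \<rho>) \<and> circ_square_integrable (L \<rho>) \<and>
     mean_resultant_length (L \<rho>) = \<rho> \<and>
     (\<forall>j\<ge>1. alpha L j \<rho> \<in> {0..1}) \<and>
     (\<forall>\<theta>. summable (\<lambda>j. alpha L (Suc j) \<rho> * cos (real (Suc j) * \<theta>)) \<and>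
          L \<rho> \<theta> = 1 / (2 * pi) *
            (1 + 2 * (\<Sum>j. alpha L (Suc j) \<rho> * cos (real (Suc j) * \<theta>)))))"

definition h_L :: "(real \<Rightarrow> real \<Rightarrow> real) \<Rightarrow> real \<Rightarrow> real" where
  "h_L L \<rho> = pi\<^sup>2 / 3 + 4 * (\<Sum>j. (-1) ^ Suc j * alpha L (Suc j) \<rho> / (real (Suc j))\<^sup>2)"

definition R_L :: "(real \<Rightarrow> real \<Rightarrow> real) \<Rightarrow> nat \<Rightarrow> nat \<Rightarrow> real \<Rightarrow> real" where
  "R_L L s t \<rho> =
     (if s = 0 then 1 / (2 * pi) * (1 + 2 * (\<Sum>j. alpha L (Suc j) \<rho> ^ t))
      else (if t = 1 \<and> s mod 4 = 2 then -1 else 1) / pi *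
             (\<Sum>j. real (Suc j) ^ (t * s) * alpha L (Suc j) \<rho> ^ t))"

text \<open>The observations are represented by their angles in \<open>[-pi, pi)\<close>; the sample of size \<open>n\<close>
  is \<open>\<Theta> 1, \<dots>, \<Theta> n\<close>.\<close>

definition circular_iid_sample ::
    "'w measure \<Rightarrow> (real \<Rightarrow> real) \<Rightarrow> (nat \<Rightarrow> 'w \<Rightarrow> real) \<Rightarrow> bool" where
  "circular_iid_sample M f \<Theta> \<longleftrightarrow>
     prob_space M \<and> prob_space.indep_vars M (\<lambda>_. borel) \<Theta> {1..} \<and>
     (\<forall>i\<ge>1. distributed M lborel (\<Theta> i) (\<lambda>x. ennreal (f x * indicator {-pi..<pi} x)))"

definition psi_hat ::
    "(real \<Rightarrow> real \<Rightarrow> real) \<Rightarrow> nat \<Rightarrow> real \<Rightarrow> nat \<Rightarrow> (nat \<Rightarrow> real) \<Rightarrow> real" where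
  "psi_hat L s \<rho> n x =
     1 / (real n)\<^sup>2 * (\<Sum>i=1..n. \<Sum>j=1..n. (deriv ^^ s) (L \<rho>) (x i - x j))"

definition MSE :: "'w measure \<Rightarrow> (nat \<Rightarrow> 'w \<Rightarrow> real) \<Rightarrow> (real \<Rightarrow> real \<Rightarrow> real) \<Rightarrow>
    (real \<Rightarrow> real) \<Rightarrow> nat \<Rightarrow> nat \<Rightarrow> real \<Rightarrow> real" where
  "MSE M \<Theta> L f s n \<rho> = (LINT \<omega>|M. (psi_hat L s \<rho> n (\<lambda>i. \<Theta> i \<omega>) - psi f s)\<^sup>2)"

text \<open>
  Leading bias and leading variance of the estimator \<open>psi_hat\<close> of \<open>psi f s\<close>, in terms of
  \<open>h = h_L L \<rho>\<close>, \<open>r1 = R_L L s 1 \<rho>\<close> and \<open>r2 = R_L L s 2 \<rho>\<close>.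
\<close>

definition lead_bias :: "(real \<Rightarrow> real) \<Rightarrow> nat \<Rightarrow> nat \<Rightarrow> real \<Rightarrow> real \<Rightarrow> real" where
  "lead_bias f s n r1 h = r1 / real n + 1 / 2 * h * psi f (s + 2)"

definition lead_var :: "(real \<Rightarrow> real) \<Rightarrow> nat \<Rightarrow> nat \<Rightarrow> real \<Rightarrow> real" where
  "lead_var f s n r2 =
     2 / (real n)\<^sup>2 * psi f 0 * r2 +
     4 / real n * (circ_int (\<lambda>\<theta>. ((deriv ^^ s) f \<theta>)\<^sup>2 * f \<theta>) - (psi f s)\<^sup>2)"

text \<open>\<open>AMSE\<close> is the asymptotic leading part of \<open>MSE\<close>; \<open>AMSE_h\<close> is obtained from it by replacing
  \<open>R_L L s 1 \<rho>\<close> and \<open>R_L L s 2 \<rho>\<close> by their asymptotic forms with constants \<open>Q1\<close> and \<open>Q2\<close>. This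
  makes it a function of \<open>h > 0\<close>, which is the function that is minimised.\<close>

definition AMSE ::
    "(real \<Rightarrow> real \<Rightarrow> real) \<Rightarrow> (real \<Rightarrow> real) \<Rightarrow> nat \<Rightarrow> nat \<Rightarrow> real \<Rightarrow> real" where
  "AMSE L f s n \<rho> =
     (lead_bias f s n (R_L L s 1 \<rho>) (h_L L \<rho>))\<^sup>2 + lead_var f s n (R_L L s 2 \<rho>)"

definition AMSE_h ::
    "(real \<Rightarrow> real) \<Rightarrow> nat \<Rightarrow> real \<Rightarrow> real \<Rightarrow> nat \<Rightarrow> real \<Rightarrow> real" where
  "AMSE_h f s Q1 Q2 n h =
     (lead_bias f s n (Q1 * h powr (- (real s + 1) / 2)) h)\<^sup>2 +
     lead_var f s n (Q2 * h powr (- (2 * real s + 1) / 2))"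

definition h_AMSE :: "(real \<Rightarrow> real) \<Rightarrow> nat \<Rightarrow> real \<Rightarrow> nat \<Rightarrow> real" where
  "h_AMSE f s Q1 n = (- (2 * Q1) / (real n * psi f (s + 2))) powr (2 / (real s + 3))"

definition T1 :: "(real \<Rightarrow> real) \<Rightarrow> nat \<Rightarrow> real \<Rightarrow> real \<Rightarrow> nat \<Rightarrow> real" where
  "T1 f s Q1 Q2 n =
     2 * psi f 0 * Q2 * (- (psi f (s + 2) / (2 * Q1))) powr ((2 * real s + 1) / (real s + 3)) *
     real n powr (- 5 / (real s + 3))"

definition T2 :: "(real \<Rightarrow> real) \<Rightarrow> nat \<Rightarrow> nat \<Rightarrow> real" where
  "T2 f s n =
     4 * (circ_int (\<lambda>\<theta>. ((deriv ^^ s) f \<theta>)\<^sup>2 * f \<theta>) - (psi f s)\<^sup>2) * real n powr (-1)"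

end

theory Submission
  imports Defs
begin

text \<open>
  Integrating by parts over a period gives \<open>\<psi>\<^sub>2\<^sub>m = (-1)\<^sup>m \<integral>(f\<^sup>(\<^sup>m\<^sup>))\<^sup>2\<close>, so \<open>Q1\<close> and
  \<open>\<psi>\<^sub>s\<^sub>+\<^sub>2\<close> have opposite signs and the leading bias vanishes at exactly one \<open>h\<^sub>0 > 0\<close>, which is
  \<open>h_AMSE\<close>. With \<open>h = h\<^sub>0 u\<close>, the squared bias is of order \<open>n\<^bsup>-4/(s+3)\<^esup> (u - u\<^bsup>-(s+1)/2\<^esup>)\<^sup>2\<close>, whereas
  the part of the variance that depends on \<open>h\<close> is of the smaller order \<open>n\<^bsup>-5/(s+3)\<^esup>\<close>. Comparing a
  minimiser with \<open>u = 1\<close> therefore forces \<open>u \<rightarrow> 1\<close>, and the minimum is asymptotically the variance at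
  \<open>h\<^sub>0\<close>, which is \<open>T1 + T2\<close>.
\<close>

section \<open>A squared power gap with a decreasing penalty\<close>

text \<open>Abstract form of the AMSE in \<open>h\<close>: \<open>b * h\<close> is the size of the
  smoothing bias, \<open>a * h powr (-p)\<close> that of the opposing bias from the diagonal terms
  of the double sum, \<open>d * h powr (-q)\<close> the \<open>h\<close>-dependent variance and
  \<open>c\<close> the rest of the variance.\<close>

definition power_risk :: "real \<Rightarrow> real \<Rightarrow> real \<Rightarrow> real \<Rightarrow> real \<Rightarrow> real \<Rightarrow> real \<Rightarrow> real" where
  "power_risk a b c d p q h = (b * h - a * h powr (-p))\<^sup>2 + d * h powr (-q) + c"

text \<open>For positive \<open>a\<close>, \<open>b\<close>, \<open>p\<close> this is the unique
  positive zero of the gap \<open>b * h - a * h powr (-p)\<close>, because the zero satisfies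
  \<open>h powr (1 + p) = a / b\<close>.\<close>

definition balance_point :: "real \<Rightarrow> real \<Rightarrow> real \<Rightarrow> real" where
  "balance_point a b p = (a / b) powr (1 / (1 + p))"

lemma balance_point_pos:
  assumes "a > 0" "b > 0"
  shows "balance_point a b p > 0"
  using assms by (simp add: balance_point_def)

lemma balance_point_eq:
  assumes "a > 0" "b > 0" "p > 0"
  shows "a * balance_point a b p powr (-p) = b * balance_point a b p"
proof -
  let ?h = "balance_point a b p"
  have "?h powr (1 + p) = a / b"
    using assms by (simp add: balance_point_def powr_powr)
  moreover have pos: "?h > 0"
    using assms by (intro balance_point_pos)
  then have "?h powr (1 + p) = ?h * ?h powr p"
    by (simp add: powr_add)
  ultimately show ?thesis
    using assms pos by (simp add: powr_minus field_simps)
qed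

lemma power_risk_at_balance_point:
  assumes "a > 0" "b > 0" "p > 0"
  shows "power_risk a b c d p q (balance_point a b p) = d * balance_point a b p powr (-q) + c"
  using balance_point_eq[OF assms] by (simp add: power_risk_def)

text \<open>The points \<open>u\<close> and \<open>u powr (-p)\<close> lie on opposite sides of 1,
  so their distance is at least that from \<open>u\<close> to 1. This trades the power gap for a
  quadratic in \<open>u - 1\<close>.\<close>

lemma abs_diff_one_le_power_gap:
  fixes u p :: real
  assumes "u > 0" "p > 0"
  shows "\<bar>u - 1\<bar> \<le> \<bar>u - u powr (-p)\<bar>"
proof (cases "u \<ge> 1")
  case True
  then have "u powr (-p) \<le> 1"
    using assms powr_mono[of "-p" 0 u] by simp
  with True show ?thesis by simp
next
  case False
  then have "u powr (-p) \<ge> 1"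
    using assms powr_mono'[of "-p" 0 u] by simp
  with False show ?thesis by simp
qed

text \<open>Rescaling by \<open>h0\<close> turns the gap into
  \<open>b * h0 * (u - u powr (-p))\<close> with \<open>u = h / h0\<close>. The gap is zero at
  \<open>h0\<close>, so a point that is no worse has squared gap at most the penalty
  \<open>d * h0 powr (-q)\<close>.\<close>

lemma power_risk_gap_bound:
  assumes "a > 0" "b > 0" "p > 0" "d > 0" "h > 0"
  defines "h0 \<equiv> balance_point a b p"
  assumes le: "power_risk a b c d p q h \<le> power_risk a b c d p q h0"
  shows "(h / h0 - 1)\<^sup>2 \<le> d * h0 powr (-q) / (b * h0)\<^sup>2"
proof -
  have h0: "h0 > 0" using assms balance_point_pos by simp
  define u where "u = h / h0"
  have u: "u > 0" "h = h0 * u" using h0 assms by (auto simp: u_def)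
  have "b * h - a * h powr (-p) = b * h0 * u - a * h0 powr (-p) * u powr (-p)"
    using u h0 by (simp add: powr_mult)
  also have "\<dots> = b * h0 * (u - u powr (-p))"
    using balance_point_eq[OF assms(1-3)] by (simp add: h0_def algebra_simps)
  finally have gap: "b * h - a * h powr (-p) = b * h0 * (u - u powr (-p))" .
  have "(b * h0)\<^sup>2 * (u - 1)\<^sup>2 \<le> (b * h0)\<^sup>2 * (u - u powr (-p))\<^sup>2"
    using abs_diff_one_le_power_gap[OF u(1) assms(3)]
    by (intro mult_left_mono) (auto simp: abs_le_square_iff)
  also have "\<dots> = (b * h - a * h powr (-p))\<^sup>2"
    by (simp add: gap power_mult_distrib)
  also have "\<dots> \<le> d * h0 powr (-q)"
  proof -
    have "d * h powr (-q) \<ge> 0" using assms by simp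
    then show ?thesis
      using le power_risk_at_balance_point[OF assms(1-3), of c d q]
      unfolding h0_def power_risk_def by linarith
  qed
  finally show ?thesis
    using h0 assms by (simp add: u_def pos_le_divide_eq mult.commute)
qed

lemma power_risk_lower:
  "power_risk a b c d p q h \<ge> d * h powr (-q) + c"
  by (simp add: power_risk_def)

text \<open>Left of the balance point the penalty alone exceeds the risk at the balance point.\<close>

lemma balance_point_le:
  assumes "a > 0" "b > 0" "p > 0" "d > 0" "q > 0" "h > 0"
    and "power_risk a b c d p q h \<le> power_risk a b c d p q (balance_point a b p)"
  shows "balance_point a b p \<le> h"
proof (rule ccontr)
  assume "\<not> ?thesis"
  then have "balance_point a b p powr (-q) < h powr (-q)"
    using assms powr_less_mono2_neg[of "-q" h "balance_point a b p"] by simp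
  then have "d * balance_point a b p powr (-q) < d * h powr (-q)"
    using assms by simp
  then show False
    using assms(7) power_risk_lower[where a=a and b=b and c=c and d=d and p=p and q=q and h=h]
      power_risk_at_balance_point[OF assms(1-3), of c d q] by linarith
qed

text \<open>The half-line is not compact, but every competitor at least as good as \<open>h0\<close>
  lies between \<open>h0\<close> (by \<open>balance_point_le\<close>) and
  \<open>h0 * (1 + sqrt K)\<close> (by \<open>power_risk_gap_bound\<close>). A minimiser on this
  compact interval is therefore global.\<close>

lemma power_risk_has_minimiser:
  assumes "a > 0" "b > 0" "p > 0" "d > 0" "q > 0"
  shows "\<exists>h. is_arg_min (power_risk a b c d p q) (\<lambda>h. h > 0) h"
proof -
  define h0 where "h0 = balance_point a b p"
  define K where "K = d * h0 powr (-q) / (b * h0)\<^sup>2"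
  have h0: "h0 > 0" using assms balance_point_pos by (simp add: h0_def)
  have K: "K \<ge> 0" using assms by (simp add: K_def)
  let ?I = "{h0..h0 * (1 + sqrt K)}"
  have h0_in: "h0 \<in> ?I" using h0 K by (simp add: algebra_simps)
  have "continuous_on ?I (power_risk a b c d p q)"
    unfolding power_risk_def using h0 by (intro continuous_intros) auto
  then obtain h where h: "h \<in> ?I"
    and min: "\<And>x. x \<in> ?I \<Longrightarrow> power_risk a b c d p q h \<le> power_risk a b c d p q x"
    using continuous_attains_inf[of ?I "power_risk a b c d p q"] h0_in by auto
  have "power_risk a b c d p q h \<le> power_risk a b c d p q x" if x: "x > 0" for x
  proof (cases "power_risk a b c d p q x \<le> power_risk a b c d p q h0")
    case True
    have "h0 \<le> x"
      using balance_point_le[OF assms x] True by (simp add: h0_def)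
    moreover have "x / h0 - 1 \<le> sqrt K"
      using power_risk_gap_bound[OF assms(1-4) x] True
      by (intro real_le_rsqrt) (simp add: h0_def K_def)
    then have "x \<le> h0 * (1 + sqrt K)"
      using h0 by (simp add: field_simps)
    ultimately show ?thesis by (intro min) auto
  next
    case False
    then show ?thesis using min[OF h0_in] by simp
  qed
  moreover have "h > 0" using h h0 by auto
  ultimately show ?thesis by (auto simp: is_arg_min_linorder)
qed

text \<open>Everything comes from comparison with \<open>h0\<close>. Dropping the square bounds the
  risk from below and its value at \<open>h0\<close> bounds it from above, which squeezes the
  normalised excess over \<open>c\<close>.\<close>

lemma power_risk_minimiser_bounds:
  assumes "a > 0" "b > 0" "p > 0" "d > 0" "q > 0"
    and min: "is_arg_min (power_risk a b c d p q) (\<lambda>h. h > 0) h"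
  defines "h0 \<equiv> balance_point a b p"
  shows "1 \<le> h / h0" "(h / h0 - 1)\<^sup>2 \<le> d * h0 powr (-q) / (b * h0)\<^sup>2"
    "(h / h0) powr (-q) \<le> (power_risk a b c d p q h - c) / (d * h0 powr (-q))"
    "(power_risk a b c d p q h - c) / (d * h0 powr (-q)) \<le> 1"
proof -
  have h0: "h0 > 0" using assms balance_point_pos by simp
  have h: "h > 0" and le: "power_risk a b c d p q h \<le> power_risk a b c d p q h0"
    using min h0 by (auto simp: is_arg_min_linorder)
  show "1 \<le> h / h0"
    using balance_point_le[OF assms(1-5) h] le h0 by (simp add: h0_def)
  show "(h / h0 - 1)\<^sup>2 \<le> d * h0 powr (-q) / (b * h0)\<^sup>2"
    using power_risk_gap_bound[OF assms(1-4) h] le by (simp add: h0_def)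
  have "d * h powr (-q) \<le> power_risk a b c d p q h - c"
    using power_risk_lower[of d h q c a b p] by simp
  then show "(h / h0) powr (-q) \<le> (power_risk a b c d p q h - c) / (d * h0 powr (-q))"
    using h h0 assms by (simp add: powr_divide field_simps)
  show "(power_risk a b c d p q h - c) / (d * h0 powr (-q)) \<le> 1"
    using le power_risk_at_balance_point[OF assms(1-3), of c d q] assms h0
    by (simp add: divide_le_eq_1)
qed

text \<open>The assumption \<open>ratio\<close> says that the penalty at the balance point is
  negligible against the squared bias scale. The quadratic bound then forces
  \<open>h n / h0 n\<close> to 1, and with it the lower end of the squeeze.\<close>

lemma power_risk_minimisers_asymp:
  fixes a c d h :: "nat \<Rightarrow> real"
  assumes "b > 0" "p > 0" "q > 0"
    and ev: "eventually (\<lambda>n. a n > 0 \<and> d n > 0 \<and>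
      is_arg_min (power_risk (a n) b (c n) (d n) p q) (\<lambda>h. h > 0) (h n)) sequentially"
  defines "h0 \<equiv> \<lambda>n. balance_point (a n) b p"
  assumes ratio: "(\<lambda>n. d n * h0 n powr (-q) / (b * h0 n)\<^sup>2) \<longlonglongrightarrow> 0"
  shows "(\<lambda>n. h n / h0 n) \<longlonglongrightarrow> 1"
    and "(\<lambda>n. (power_risk (a n) b (c n) (d n) p q (h n) - c n) / (d n * h0 n powr (-q))) \<longlonglongrightarrow> 1"
proof -
  have "(\<lambda>n. (h n / h0 n - 1)\<^sup>2) \<longlonglongrightarrow> 0"
  proof (rule tendsto_sandwich[OF _ _ tendsto_const ratio])
    show "eventually (\<lambda>n. (h n / h0 n - 1)\<^sup>2 \<le> d n * h0 n powr (-q) / (b * h0 n)\<^sup>2) sequentially"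
      using ev by eventually_elim
        (use power_risk_minimiser_bounds(2) assms(1-3) in \<open>auto simp: h0_def\<close>)
  qed simp
  from tendsto_real_sqrt[OF this] have "(\<lambda>n. \<bar>h n / h0 n - 1\<bar>) \<longlonglongrightarrow> 0"
    by simp
  then have "(\<lambda>n. h n / h0 n - 1) \<longlonglongrightarrow> 0"
    by (rule tendsto_rabs_zero_cancel)
  then show lim: "(\<lambda>n. h n / h0 n) \<longlonglongrightarrow> 1"
    using Lim_null by blast
  have lim': "(\<lambda>n. (h n / h0 n) powr (-q)) \<longlonglongrightarrow> 1"
    using tendsto_powr[OF lim tendsto_const, of "-q"] by simp
  show "(\<lambda>n. (power_risk (a n) b (c n) (d n) p q (h n) - c n) / (d n * h0 n powr (-q))) \<longlonglongrightarrow> 1"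
  proof (rule tendsto_sandwich[OF _ _ lim' tendsto_const])
    show "eventually (\<lambda>n. (h n / h0 n) powr (-q) \<le>
        (power_risk (a n) b (c n) (d n) p q (h n) - c n) / (d n * h0 n powr (-q))) sequentially"
      using ev by eventually_elim
        (use power_risk_minimiser_bounds(3) assms(1-3) in \<open>auto simp: h0_def\<close>)
    show "eventually (\<lambda>n. (power_risk (a n) b (c n) (d n) p q (h n) - c n) /
        (d n * h0 n powr (-q)) \<le> 1) sequentially"
      using ev by eventually_elim
        (use power_risk_minimiser_bounds(4) assms(1-3) in \<open>auto simp: h0_def\<close>)
  qed
qed

section \<open>Integrals over a period\<close>

text \<open>The half-open and the closed period differ by the null set \<open>{pi}\<close>; the
  closed one gives access to the calculus of continuous functions on compact intervals.\<close>

lemma circ_int_eq_integral: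
  assumes "continuous_on {-pi..pi} g"
  shows "circ_int g = integral {-pi..pi} g"
proof -
  have "set_integrable lborel {-pi..pi} g"
    using borel_integrable_atLeastAtMost'[OF assms] .
  then have "set_integrable lborel {-pi..<pi} g"
    by (rule set_integrable_subset) auto
  then have "circ_int g = integral {-pi..<pi} g"
    unfolding circ_int_def by (rule set_borel_integral_eq_integral)
  also have "\<dots> = integral {-pi..pi} g"
    by (rule integral_subset_negligible) (auto intro: negligible_subset[of "{pi}"])
  finally show ?thesis .
qed

text \<open>\<open>deriv\<close> chooses among the derivatives at a point, and translation by the
  period preserves the set to choose from, so the identity holds even where that set is
  empty.\<close>

lemma deriv_periodic:
  fixes g :: "real \<Rightarrow> real"
  assumes "\<And>x. g (x + c) = g x"
  shows "deriv g (x + c) = deriv g x"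
proof -
  have "(g has_field_derivative D) (at (x + c)) \<longleftrightarrow> (g has_field_derivative D) (at x)" for D
    using DERIV_shift[of g D x c] assms by simp
  then show ?thesis by (simp add: deriv_def)
qed

lemma higher_deriv_periodic:
  fixes g :: "real \<Rightarrow> real"
  assumes "\<And>x. g (x + c) = g x"
  shows "(deriv ^^ k) g (x + c) = (deriv ^^ k) g x"
proof (induction k arbitrary: x)
  case (Suc k)
  then show ?case by (simp add: deriv_periodic)
qed (simp add: assms)

text \<open>The boundary term cancels because \<open>g * h\<close> takes the same value at both ends
  of the period.\<close>

lemma periodic_integral_by_parts:
  fixes g h :: "real \<Rightarrow> real"
  assumes "\<And>x. g differentiable (at x)" "\<And>x. h differentiable (at x)"
    and cont: "continuous_on UNIV (deriv g)" "continuous_on UNIV (deriv h)"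
    and "\<And>x. g (x + 2 * pi) = g x" "\<And>x. h (x + 2 * pi) = h x"
  shows "integral {-pi..pi} (\<lambda>x. deriv g x * h x) = - integral {-pi..pi} (\<lambda>x. g x * deriv h x)"
proof -
  have g: "(g has_real_derivative deriv g x) (at x)" and h: "(h has_real_derivative deriv h x) (at x)" for x
    using assms(1,2) by (auto simp: DERIV_deriv_iff_real_differentiable)
  have cgh: "continuous_on UNIV g" "continuous_on UNIV h"
    using assms(1,2) by (auto simp: continuous_on_eq_continuous_at intro: differentiable_imp_continuous_within)
  have int: "(\<lambda>x. deriv g x * h x) integrable_on {-pi..pi}" "(\<lambda>x. g x * deriv h x) integrable_on {-pi..pi}"
    using cgh cont by (intro integrable_continuous_real continuous_intros; blast intro: continuous_on_subset)+
  have "((\<lambda>x. deriv g x * h x + g x * deriv h x) has_integral (g pi * h pi - g (-pi) * h (-pi))) {-pi..pi}"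
  proof (rule fundamental_theorem_of_calculus)
    fix x assume "x \<in> {-pi..pi}"
    show "((\<lambda>x. g x * h x) has_vector_derivative deriv g x * h x + g x * deriv h x) (at x within {-pi..pi})"
      unfolding has_real_derivative_iff_has_vector_derivative[symmetric]
      by (rule DERIV_subset) (auto intro!: derivative_eq_intros g h)
  qed simp
  moreover have "g pi = g (-pi)" "h pi = h (-pi)"
    using assms(5,6)[of "-pi"] by simp_all
  ultimately have "integral {-pi..pi} (\<lambda>x. deriv g x * h x + g x * deriv h x) = 0"
    by (simp add: integral_unique)
  then show ?thesis
    using integral_add[OF int] by simp
qed

section \<open>Periodic functions with \<open>k\<close> continuous derivatives\<close>

locale smooth_periodic =
  fixes f :: "real \<Rightarrow> real" and k :: nat
  assumes periodic: "\<And>x. f (x + 2 * pi) = f x"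
    and differentiable: "times_differentiable k f"
    and continuous_top: "continuous_on UNIV ((deriv ^^ k) f)"
begin

lemma continuous_higher_deriv:
  assumes "i \<le> k"
  shows "continuous_on A ((deriv ^^ i) f)"
proof -
  have "continuous_on UNIV ((deriv ^^ i) f)"
  proof (cases "i = k")
    case False
    then have "(deriv ^^ i) f differentiable (at x)" for x
      using differentiable assms by (auto simp: times_differentiable_def)
    then show ?thesis
      by (auto simp: continuous_on_eq_continuous_at intro: differentiable_imp_continuous_within)
  qed (simp add: continuous_top)
  then show ?thesis by (rule continuous_on_subset) simp
qed

lemma continuous_f: "continuous_on A f"
  using continuous_higher_deriv[of 0] by simp

lemma integral_higher_deriv_swap:
  assumes "i < k" "j < k"
  shows "integral {-pi..pi} (\<lambda>x. (deriv ^^ Suc i) f x * (deriv ^^ j) f x) =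
    - integral {-pi..pi} (\<lambda>x. (deriv ^^ i) f x * (deriv ^^ Suc j) f x)"
proof -
  have "integral {-pi..pi} (\<lambda>x. deriv ((deriv ^^ i) f) x * (deriv ^^ j) f x) =
    - integral {-pi..pi} (\<lambda>x. (deriv ^^ i) f x * deriv ((deriv ^^ j) f) x)"
  proof (rule periodic_integral_by_parts)
    show "continuous_on UNIV (deriv ((deriv ^^ i) f))" "continuous_on UNIV (deriv ((deriv ^^ j) f))"
      using continuous_higher_deriv[of "Suc i"] continuous_higher_deriv[of "Suc j"] assms by simp_all
  qed (use differentiable assms in \<open>auto simp: times_differentiable_def higher_deriv_periodic periodic\<close>)
  then show ?thesis by simp
qed

text \<open>Derivatives are moved one at a time from the first factor to the second, each move
  flipping the sign; after \<open>m\<close> moves both factors have order \<open>m\<close>. In the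
  induction, \<open>j\<close> counts the moves.\<close>

lemma psi_even_eq:
  assumes "2 * m \<le> k"
  shows "psi f (2 * m) = (-1) ^ m * integral {-pi..pi} (\<lambda>x. ((deriv ^^ m) f x)\<^sup>2)"
proof -
  have "integral {-pi..pi} (\<lambda>x. (deriv ^^ (2 * m)) f x * f x) =
      (-1) ^ j * integral {-pi..pi} (\<lambda>x. (deriv ^^ (2 * m - j)) f x * (deriv ^^ j) f x)"
    if "j \<le> m" for j
    using that
  proof (induction j)
    case (Suc j)
    then have eq: "2 * m - j = Suc (2 * m - Suc j)" by simp
    have "integral {-pi..pi} (\<lambda>x. (deriv ^^ (2 * m - j)) f x * (deriv ^^ j) f x) =
        - integral {-pi..pi} (\<lambda>x. (deriv ^^ (2 * m - Suc j)) f x * (deriv ^^ Suc j) f x)"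
      unfolding eq using Suc assms by (intro integral_higher_deriv_swap) auto
    then show ?case using Suc by simp
  qed simp
  from this[of m] show ?thesis
    unfolding psi_def using assms
    by (subst circ_int_eq_integral)
      (auto intro!: continuous_intros continuous_higher_deriv continuous_f simp: power2_eq_square mult_2)
qed

end

section \<open>Positivity of \<open>psi f 0\<close> and of the variances for a smooth
  density\<close>

locale smooth_density = smooth_periodic +
  assumes density: "circular_density f"
begin

lemma nonneg: "f x \<ge> 0"
  using density by (simp add: circular_density_def)

lemma integral_f: "integral {-pi..pi} f = 1"
  using density circ_int_eq_integral[OF continuous_f] by (simp add: circular_density_def)

text \<open>\<open>psi f 0\<close> is the integral of the square of \<open>f\<close>; were it zero,
  the continuous \<open>f\<close> would vanish on the period, against total mass 1.\<close>

lemma psi_0_pos: "psi f 0 > 0"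
proof -
  have eq: "psi f 0 = integral {-pi..pi} (\<lambda>x. f x * f x)"
    unfolding psi_def by (subst circ_int_eq_integral) (auto intro!: continuous_intros continuous_f)
  have "psi f 0 \<noteq> 0"
  proof
    assume "psi f 0 = 0"
    then have "\<forall>x\<in>{-pi..pi}. f x * f x = 0"
      unfolding eq by (subst (asm) integral_eq_0_iff) (auto intro!: continuous_intros continuous_f)
    then have "integral {-pi..pi} f = integral {-pi..pi} (\<lambda>x. 0)"
      by (intro integral_cong) auto
    then show False using integral_f by simp
  qed
  moreover have "psi f 0 \<ge> 0"
    unfolding eq by (rule integral_nonneg) (auto intro!: integrable_continuous_real continuous_intros continuous_f)
  ultimately show ?thesis by simp
qed

text \<open>\<open>psi f i\<close> is the mean of the \<open>i\<close>-th derivative under the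
  density \<open>f\<close>, so the left side is a variance. The centred form on the right shows its
  sign and what its vanishing means.\<close>

lemma variance_eq:
  assumes "i \<le> k"
  shows "circ_int (\<lambda>x. ((deriv ^^ i) f x)\<^sup>2 * f x) - (psi f i)\<^sup>2 =
    integral {-pi..pi} (\<lambda>x. ((deriv ^^ i) f x - psi f i)\<^sup>2 * f x)"
proof -
  let ?g = "(deriv ^^ i) f" and ?m = "psi f i"
  note cont = continuous_higher_deriv[OF assms] continuous_f
  have psi: "integral {-pi..pi} (\<lambda>x. ?g x * f x) = ?m"
    unfolding psi_def by (subst circ_int_eq_integral) (auto intro!: continuous_intros cont)
  have "integral {-pi..pi} (\<lambda>x. (?g x - ?m)\<^sup>2 * f x) =
      integral {-pi..pi} (\<lambda>x. (?g x)\<^sup>2 * f x - 2 * ?m * (?g x * f x) + ?m\<^sup>2 * f x)"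
    by (simp add: power2_diff algebra_simps)
  also have "\<dots> = integral {-pi..pi} (\<lambda>x. (?g x)\<^sup>2 * f x)
      - 2 * ?m * integral {-pi..pi} (\<lambda>x. ?g x * f x) + ?m\<^sup>2 * integral {-pi..pi} f"
    by (subst integral_add integral_diff;
        (intro integrable_continuous_real continuous_intros cont)?)+ simp
  also have "\<dots> = integral {-pi..pi} (\<lambda>x. (?g x)\<^sup>2 * f x) - ?m\<^sup>2"
    by (simp add: psi integral_f power2_eq_square)
  finally show ?thesis
    by (subst circ_int_eq_integral) (auto intro!: continuous_intros cont)
qed

lemma variance_nonneg:
  assumes "i \<le> k"
  shows "circ_int (\<lambda>x. ((deriv ^^ i) f x)\<^sup>2 * f x) - (psi f i)\<^sup>2 \<ge> 0"
  unfolding variance_eq[OF assms] using nonneg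
  by (intro integral_nonneg)
    (auto intro!: integrable_continuous_real continuous_intros continuous_higher_deriv[OF assms] continuous_f)

text \<open>If \<open>f(\<Theta>)\<close> has variance zero then \<open>f\<close> takes only the values \<open>0\<close> and \<open>\<psi>\<^sub>0\<close>, hence is constant
  by connectedness.\<close>

lemma variance_pos:
  assumes "2 \<le> k" "psi f 2 \<noteq> 0"
  shows "circ_int (\<lambda>x. (f x)\<^sup>2 * f x) - (psi f 0)\<^sup>2 > 0"
proof -
  have "circ_int (\<lambda>x. (f x)\<^sup>2 * f x) - (psi f 0)\<^sup>2 \<noteq> 0"
  proof
    assume "circ_int (\<lambda>x. (f x)\<^sup>2 * f x) - (psi f 0)\<^sup>2 = 0"
    then have "integral {-pi..pi} (\<lambda>x. (f x - psi f 0)\<^sup>2 * f x) = 0"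
      using variance_eq[of 0] by simp
    then have "\<forall>x\<in>{-pi..pi}. (f x - psi f 0)\<^sup>2 * f x = 0"
      using nonneg by (subst (asm) integral_eq_0_iff) (auto intro!: continuous_intros continuous_f)
    then have "f ` {-pi..pi} \<subseteq> {0, psi f 0}" by auto
    then have "finite (f ` {-pi..pi})" by (rule finite_subset) simp
    moreover have "connected (f ` {-pi..pi})"
      by (intro connected_continuous_image continuous_f) simp
    ultimately obtain c where "f ` {-pi..pi} \<subseteq> {c}"
      using connected_finite_iff_sing by (metis empty_subsetI order_refl)
    then have const: "f x = c" if "x \<in> {-pi<..<pi}" for x
      using that \<open>f ` {-pi..pi} \<subseteq> {c}\<close> by (force simp: image_subset_iff)
    \<comment> \<open>Applied first to \<open>f\<close> and then to \<open>deriv f\<close>. On the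
      open interval every point has a neighbourhood where the function is constant; at an endpoint
      constancy would be known on one side only.\<close>
    have local0: "deriv g x = 0" if "\<And>y. y \<in> {-pi<..<pi} \<Longrightarrow> g y = d" "x \<in> {-pi<..<pi}"
      for g :: "real \<Rightarrow> real" and d x
    proof -
      have "eventually (\<lambda>y. y \<in> {-pi<..<pi}) (nhds x)"
        using that(2) by (intro eventually_nhds_in_open) auto
      then have "eventually (\<lambda>y. g y = d) (nhds x)"
        by eventually_elim (rule that(1))
      then show ?thesis
        by (subst deriv_cong_ev[where g = "\<lambda>_. d" and y = x]) auto
    qed
    have "deriv f x = 0" if "x \<in> {-pi<..<pi}" for x
      using const that by (rule local0)
    then have "(deriv ^^ 2) f x = 0" if "x \<in> {-pi<..<pi}" for x
      unfolding numeral_2_eq_2 using local0[OF _ that, of "deriv f" 0] by simp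
    moreover have "psi f 2 = integral {-pi..pi} (\<lambda>x. (deriv ^^ 2) f x * f x)"
      unfolding psi_def using \<open>2 \<le> k\<close>
      by (subst circ_int_eq_integral) (auto intro!: continuous_intros continuous_higher_deriv continuous_f)
    \<comment> \<open>The endpoints, where the second derivative has not been computed, form a null
      set.\<close>
    ultimately have "psi f 2 = integral {-pi..pi} (\<lambda>x. 0 :: real)"
      using integral_spike[of "{-pi, pi}" "{-pi..pi}" "\<lambda>x. (deriv ^^ 2) f x * f x" "\<lambda>x. 0"]
      by force
    then have "psi f 2 = 0" by simp
    with assms show False by simp
  qed
  with variance_nonneg[of 0] show ?thesis by simp
qed

end

section \<open>Asymptotics of the minimiser and of the minimum of \<open>AMSE_h\<close>\<close>

theorem corollary2:
  fixes M :: "'w measure" and \<Theta> :: "nat \<Rightarrow> 'w \<Rightarrow> real"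
    and f :: "real \<Rightarrow> real" and L :: "real \<Rightarrow> real \<Rightarrow> real" and \<rho> :: "nat \<Rightarrow> real"
    and s :: nat and Q1 Q2 :: real
  assumes s_even: "even s"
    and f_density: "circular_density f"
    and sample: "circular_iid_sample M f \<Theta>"
    and L_family: "circular_kernel_family L"
    and rho_range: "\<forall>n. \<rho> n \<in> {0..<1}"
    and psi_nonzero: "psi f (s + 2) \<noteq> 0"
    and A1: "times_differentiable (s + 2) f"
      "continuous_on UNIV ((deriv ^^ (s + 2)) f)"
      "circ_square_integrable ((deriv ^^ (s + 2)) f)"
    and A2: "\<forall>r\<in>{0..<1}. circular_density (L r) \<and> bounded (range (L r)) \<and>
        (\<forall>\<theta>. L r (-\<theta>) = L r \<theta>) \<and> circ_unimodal (L r) \<and>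
        times_differentiable s (L r) \<and> circ_square_integrable ((deriv ^^ s) (L r))"
    and A3: "(\<lambda>n. h_L L (\<rho> n)) \<longlonglongrightarrow> 0"
      "filterlim (\<lambda>n. R_L L s 2 (\<rho> n)) at_top sequentially"
      "(\<lambda>n. R_L L s 2 (\<rho> n) / real n) \<longlonglongrightarrow> 0"
    and A4: "filterlim (\<lambda>n. \<bar>R_L L s 1 (\<rho> n)\<bar>) at_top sequentially"
      "(\<lambda>n. R_L L s 1 (\<rho> n) / real n) \<longlonglongrightarrow> 0"
    and E1: "(\<lambda>n. circ_int (\<lambda>\<theta>. \<theta> ^ 4 * L (\<rho> n) \<theta>)) \<in> o(\<lambda>n. h_L L (\<rho> n))"
    and E2: "(\<lambda>n. circ_int (\<lambda>\<theta>. \<theta>\<^sup>2 * ((deriv ^^ s) (L (\<rho> n)) \<theta>)\<^sup>2)) \<in> o(\<lambda>n. R_L L s 2 (\<rho> n))"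
    and E3: "(\<lambda>n. R_L L s 2 (\<rho> n) / (Q2 * h_L L (\<rho> n) powr (- (2 * real s + 1) / 2))) \<longlonglongrightarrow> 1"
    and E4: "(\<lambda>n. R_L L s 1 (\<rho> n) / (Q1 * h_L L (\<rho> n) powr (- (real s + 1) / 2))) \<longlonglongrightarrow> 1"
      "sgn Q1 = (-1) ^ (s div 2)"
  shows "(\<forall>n\<ge>1. \<exists>h. is_arg_min (AMSE_h f s Q1 Q2 n) (\<lambda>h. h > 0) h) \<and>
    (\<forall>hopt :: nat \<Rightarrow> real.
       (\<forall>n\<ge>1. is_arg_min (AMSE_h f s Q1 Q2 n) (\<lambda>h. h > 0) (hopt n)) \<longrightarrow>
       (\<lambda>n. hopt n / h_AMSE f s Q1 n) \<longlonglongrightarrow> 1) \<and>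
    ((\<lambda>n. circ_int (\<lambda>\<theta>. \<theta> ^ 4 * L (\<rho> n) \<theta>)) \<in> o(\<lambda>n. h_L L (\<rho> n) powr (5 / 4)) \<longrightarrow>
       (\<lambda>n. INF h\<in>{0<..}. AMSE_h f s Q1 Q2 n h)
         \<in> O(\<lambda>n. real n powr (- min 5 (real s + 3) / (real s + 3))) \<and>
       (s > 2 \<longrightarrow>
         (\<lambda>n. (INF h\<in>{0<..}. AMSE_h f s Q1 Q2 n h) / T1 f s Q1 Q2 n) \<longlonglongrightarrow> 1) \<and>
       (s = 0 \<longrightarrow>
         (\<lambda>n. (INF h\<in>{0<..}. AMSE_h f s Q1 Q2 n h) / T2 f s n) \<longlonglongrightarrow> 1) \<and>
       (s = 2 \<longrightarrow>
         (\<lambda>n. (INF h\<in>{0<..}. AMSE_h f s Q1 Q2 n h) / (T1 f s Q1 Q2 n + T2 f s n)) \<longlonglongrightarrow> 1))"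
proof -
  interpret smooth_density f "s + 2"
    using f_density A1 by unfold_locales (auto simp: circular_density_def)

  \<comment> \<open>Parameters that turn \<open>AMSE_h\<close> into \<open>power_risk\<close>.
    Absolute values suffice because the two bias terms will turn out to have opposite signs.\<close>
  define a where "a = \<bar>Q1\<bar>"
  define b where "b = \<bar>psi f (s + 2)\<bar> / 2"
  define d where "d = 2 * psi f 0 * Q2"
  define V where "V = circ_int (\<lambda>\<theta>. ((deriv ^^ s) f \<theta>)\<^sup>2 * f \<theta>) - (psi f s)\<^sup>2"
  define p where "p = (real s + 1) / 2"
  define q where "q = (2 * real s + 1) / 2"
  define h0 where "h0 = h_AMSE f s Q1"

  \<comment> \<open>With \<open>I\<close> the integral of a square, \<open>psi f (s + 2)\<close> has
    the sign of \<open>-((-1) ^ (s div 2))\<close>, while \<open>Q1\<close> has that of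
    \<open>(-1) ^ (s div 2)\<close>; nonvanishing of \<open>psi f (s + 2)\<close> makes
    \<open>I\<close> positive.\<close>
  have opposite: "Q1 * psi f (s + 2) < 0"
  proof -
    define I where "I = integral {-pi..pi} (\<lambda>x. ((deriv ^^ (s div 2 + 1)) f x)\<^sup>2)"
    have "I \<ge> 0"
      unfolding I_def using s_even
      by (intro integral_nonneg integrable_continuous_real continuous_intros continuous_higher_deriv) auto
    moreover have psi: "psi f (s + 2) = - ((-1) ^ (s div 2)) * I"
      using psi_even_eq[of "s div 2 + 1"] s_even by (auto simp: I_def)
    ultimately have "I > 0"
      using psi_nonzero by (cases "I = 0") auto
    moreover have "Q1 = (-1) ^ (s div 2) * \<bar>Q1\<bar>" "Q1 \<noteq> 0"
      using E4(2) mult_sgn_abs[of Q1] by auto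
    then have "Q1 * psi f (s + 2) = - ((-1) ^ (s div 2) * (-1) ^ (s div 2)) * (\<bar>Q1\<bar> * I)"
      unfolding psi by (metis (no_types, opaque_lifting) mult.assoc mult.left_commute mult_minus_left mult_minus_right)
    then have "Q1 * psi f (s + 2) = - (\<bar>Q1\<bar> * I)"
      by (simp add: power_add[symmetric])
    ultimately show ?thesis
      using \<open>Q1 \<noteq> 0\<close> by simp
  qed
  \<comment> \<open>The sign is read off from \<open>E3\<close>: the ratio is eventually positive,
    so is its numerator by \<open>A3\<close>, and a power is never negative.\<close>
  have Q2_pos: "Q2 > 0"
  proof -
    have "eventually (\<lambda>n. R_L L s 2 (\<rho> n) / (Q2 * h_L L (\<rho> n) powr (- (2 * real s + 1) / 2)) > 0) sequentially"
      by (rule order_tendstoD(1)[OF E3]) simp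
    moreover have "eventually (\<lambda>n. R_L L s 2 (\<rho> n) > 0) sequentially"
      using A3(2) by (simp add: filterlim_at_top_dense)
    ultimately have "eventually (\<lambda>n. Q2 > 0) sequentially"
      by eventually_elim (auto simp: zero_less_divide_iff zero_less_mult_iff)
    then show ?thesis by simp
  qed
  have pos: "a > 0" "b > 0" "p > 0" "d > 0" "q > 0"
    using opposite Q2_pos psi_0_pos by (auto simp: a_def b_def p_def d_def q_def)
  have V: "V \<ge> 0"
    using variance_nonneg[of s] by (simp add: V_def)

  have AMSE_h_eq: "AMSE_h f s Q1 Q2 n = power_risk (a / real n) b (4 / real n * V) (d / (real n)\<^sup>2) p q" for n
  proof
    fix h
    \<comment> \<open>The bias equals plus or minus the gap, depending on the sign of
      \<open>Q1\<close>; the square removes the ambiguity.\<close>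
    have "(Q1 * x / real n + 1 / 2 * h * psi f (s + 2))\<^sup>2 = (b * h - a / real n * x)\<^sup>2" for x
    proof (cases "Q1 > 0")
      case True
      then show ?thesis using opposite
        by (auto simp: a_def b_def mult_less_0_iff power2_eq_square algebra_simps)
    next
      case False
      then show ?thesis using opposite
        by (auto simp: a_def b_def mult_less_0_iff power2_eq_square algebra_simps)
    qed
    moreover have "- (real s + 1) / 2 = - p" "- (2 * real s + 1) / 2 = - q"
      by (simp_all add: p_def q_def field_simps)
    ultimately show "AMSE_h f s Q1 Q2 n h = power_risk (a / real n) b (4 / real n * V) (d / (real n)\<^sup>2) p q h"
      unfolding AMSE_h_def power_risk_def lead_bias_def lead_var_def d_def V_def by simp
  qed

  have ratio_eq: "- (psi f (s + 2) / (2 * Q1)) = b / a"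
    using opposite by (auto simp: a_def b_def mult_less_0_iff field_simps)
  have h0_eq: "h0 n = balance_point (a / real n) b p" for n
  proof -
    have "- (2 * Q1) / (real n * psi f (s + 2)) = a / real n / b"
      \<comment> \<open>At \<open>n = 0\<close> both sides are zero, as division by zero is zero.
        The identity is thus unconditional and can rewrite under the binder of a sequence.\<close>
      using opposite by (cases "n = 0") (auto simp: a_def b_def mult_less_0_iff field_simps)
    moreover have "2 / (real s + 3) = 1 / (1 + p)" by (simp add: p_def field_simps)
    ultimately show ?thesis by (simp add: h0_def h_AMSE_def balance_point_def)
  qed
  have h0_powr: "h0 n powr x = (a / b) powr (x * 2 / (real s + 3)) * real n powr (- (x * 2 / (real s + 3)))"
    if "n \<ge> 1" for n x
  proof -
    have "h0 n powr x = (a / b / real n) powr (x * 2 / (real s + 3))"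
      by (simp add: h0_eq balance_point_def powr_powr p_def field_simps)
    then show ?thesis
      using pos that by (simp add: powr_divide powr_minus powr_mult field_simps)
  qed

  \<comment> \<open>Orders of \<open>T1\<close>, \<open>T2\<close> and of the penalty relative to
    the squared bias\<close>
  define K where "K = d * (b / a) powr ((2 * real s + 1) / (real s + 3))"
  have K: "K > 0" using pos by (simp add: K_def)
  have T1: "T1 f s Q1 Q2 n = K * real n powr (- 5 / (real s + 3))" for n
    unfolding T1_def ratio_eq K_def d_def by simp
  have T2: "T2 f s n = 4 * V * real n powr (-1)" for n
    by (simp add: T2_def V_def)
  have T2': "T2 f s n = 4 / real n * V" if "n \<ge> 1" for n
    using that by (simp add: T2 powr_minus_divide)
  have T1_pos: "T1 f s Q1 Q2 n > 0" if "n \<ge> 1" for n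
    using K that by (simp add: T1)
  \<comment> \<open>\<open>T1\<close> is exactly the penalty at \<open>h0\<close>: the exponent
    \<open>-5 / (s + 3)\<close> is \<open>(2 * s + 1) / (s + 3)\<close> from
    \<open>h0 n powr (-q)\<close>, minus 2 from the variance factor.\<close>
  have T1': "T1 f s Q1 Q2 n = d / (real n)\<^sup>2 * h0 n powr (-q)" if "n \<ge> 1" for n
  proof -
    let ?r = "(2 * real s + 1) / (real s + 3)"
    have "h0 n powr (-q) = (b / a) powr ?r * real n powr ?r"
    proof -
      have exponent: "-q * 2 / (real s + 3) = - ?r" by (simp add: q_def field_simps)
      have "(a / b) powr (- r) * real n powr (- (- r)) = (b / a) powr r * real n powr r" for r
        using pos by (simp add: powr_minus powr_divide)
      then show ?thesis unfolding h0_powr[OF that] exponent .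
    qed
    moreover have "real n powr (?r - 2) = real n powr ?r / (real n)\<^sup>2"
      using that by (simp add: powr_diff)
    moreover have "- 5 / (real s + 3) = ?r - 2" by (simp add: field_simps)
    ultimately show ?thesis unfolding T1 K_def by (simp only: times_divide_eq_right times_divide_eq_left mult.assoc)
  qed

  \<comment> \<open>The penalty has order \<open>-5 / (s + 3)\<close> in \<open>n\<close> and the
    square of \<open>h0 n\<close> has order \<open>-4 / (s + 3)\<close>, which leaves
    \<open>-1 / (s + 3)\<close>.\<close>
  have "(\<lambda>n. K / (b\<^sup>2 * (a / b) powr (4 / (real s + 3))) * real n powr (- (1 / (real s + 3)))) \<longlonglongrightarrow> 0"
    by (intro tendsto_mult_right_zero tendsto_neg_powr filterlim_real_sequentially) simp
  moreover have "eventually (\<lambda>n. K / (b\<^sup>2 * (a / b) powr (4 / (real s + 3))) * real n powr (- (1 / (real s + 3))) =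
      d / (real n)\<^sup>2 * h0 n powr (-q) / (b * h0 n)\<^sup>2) sequentially"
    using eventually_ge_at_top[of 1]
  proof eventually_elim
    case (elim n)
    have "h0 n > 0"
      unfolding h0_eq using elim pos by (intro balance_point_pos) auto
    then have "(h0 n)\<^sup>2 = (a / b) powr (4 / (real s + 3)) * real n powr (- (4 / (real s + 3)))"
      using h0_powr[OF elim, of 2] by simp
    moreover have "real n powr (- (1 / (real s + 3))) =
        real n powr (- 5 / (real s + 3)) / real n powr (- (4 / (real s + 3)))"
      by (simp add: powr_diff[symmetric] diff_divide_distrib[symmetric] minus_divide_left del: minus_divide_left[symmetric])
    ultimately show ?case
      unfolding T1'[OF elim, symmetric] T1 by (simp add: power_mult_distrib mult.assoc)
  qed
  ultimately have gap: "(\<lambda>n. d / (real n)\<^sup>2 * h0 n powr (-q) / (b * h0 n)\<^sup>2) \<longlonglongrightarrow> 0"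
    by (rule Lim_transform_eventually)

  \<comment> \<open>Minimisers and the infimum\<close>
  have ex: "\<exists>h. is_arg_min (AMSE_h f s Q1 Q2 n) (\<lambda>h. h > 0) h" if "n \<ge> 1" for n
    unfolding AMSE_h_eq using that pos by (intro power_risk_has_minimiser) auto
  have asymp: "(\<lambda>n. hopt n / h0 n) \<longlonglongrightarrow> 1"
    "(\<lambda>n. (AMSE_h f s Q1 Q2 n (hopt n) - 4 / real n * V) / (d / (real n)\<^sup>2 * h0 n powr (-q))) \<longlonglongrightarrow> 1"
    if "\<forall>n\<ge>1. is_arg_min (AMSE_h f s Q1 Q2 n) (\<lambda>h. h > 0) (hopt n)" for hopt
  proof -
    have ev: "eventually (\<lambda>n. a / real n > 0 \<and> d / (real n)\<^sup>2 > 0 \<and>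
        is_arg_min (power_risk (a / real n) b (4 / real n * V) (d / (real n)\<^sup>2) p q) (\<lambda>h. h > 0) (hopt n)) sequentially"
      using eventually_ge_at_top[of 1]
      by eventually_elim (use that pos in \<open>auto simp: AMSE_h_eq\<close>)
    note * = power_risk_minimisers_asymp[OF pos(2,3,5) ev, folded h0_eq, OF gap]
    show "(\<lambda>n. hopt n / h0 n) \<longlonglongrightarrow> 1" by (rule *)
    show "(\<lambda>n. (AMSE_h f s Q1 Q2 n (hopt n) - 4 / real n * V) / (d / (real n)\<^sup>2 * h0 n powr (-q))) \<longlonglongrightarrow> 1"
      unfolding AMSE_h_eq by (rule *)
  qed

  define m where "m n = (INF h\<in>{0<..}. AMSE_h f s Q1 Q2 n h)" for n
  \<comment> \<open>One minimiser is chosen for each \<open>n\<close>; the value \<open>m n\<close>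
    does not depend on the choice.\<close>
  obtain hopt where hopt: "\<forall>n\<ge>1. is_arg_min (AMSE_h f s Q1 Q2 n) (\<lambda>h. h > 0) (hopt n)"
    using ex by metis
  have m_eq: "m n = AMSE_h f s Q1 Q2 n (hopt n)" if "n \<ge> 1" for n
    unfolding m_def using hopt that
    by (intro cInf_eq_minimum) (auto simp: is_arg_min_linorder)
  \<comment> \<open>For \<open>n \<ge> 1\<close>, \<open>T2\<close> is the \<open>h\<close>-free
    part of the risk and \<open>T1\<close> the penalty at \<open>h0\<close>, so this is the limit of
    the normalised excess.\<close>
  have m_lim: "(\<lambda>n. (m n - T2 f s n) / T1 f s Q1 Q2 n) \<longlonglongrightarrow> 1"
    using asymp(2)[OF hopt]
    by (rule Lim_transform_eventually)
      (use eventually_ge_at_top[of 1] in \<open>eventually_elim, simp add: m_eq T1' T2'\<close>)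

  \<comment> \<open>\<open>T1\<close> decays with exponent \<open>5 / (s + 3)\<close> and
    \<open>T2\<close> at least with \<open>1 = (s + 3) / (s + 3)\<close>; the smaller exponent
    governs the sum.\<close>
  have bigo: "m \<in> O(\<lambda>n. real n powr (- min 5 (real s + 3) / (real s + 3)))"
  proof -
    let ?g = "\<lambda>n. real n powr (- min 5 (real s + 3) / (real s + 3))"
    have "(\<lambda>n. m n - T2 f s n) \<in> O(T1 f s Q1 Q2)"
      by (rule bigoI_tendsto[OF m_lim])
        (use eventually_ge_at_top[of 1] in \<open>eventually_elim, use T1_pos in force\<close>)
    also have "T1 f s Q1 Q2 \<in> O(?g)"
    proof (rule bigoI[of _ K])
      show "eventually (\<lambda>n. norm (T1 f s Q1 Q2 n) \<le> K * norm (?g n)) sequentially"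
        using eventually_ge_at_top[of 1] by eventually_elim
          (use K in \<open>auto simp: T1 abs_mult intro!: mult_left_mono powr_mono divide_right_mono\<close>)
    qed
    finally have "(\<lambda>n. m n - T2 f s n) \<in> O(?g)" .
    moreover have "T2 f s \<in> O(?g)"
    proof (rule bigoI[of _ "4 * V"])
      show "eventually (\<lambda>n. norm (T2 f s n) \<le> 4 * V * norm (?g n)) sequentially"
        using eventually_ge_at_top[of 1]
      proof eventually_elim
        case (elim n)
        have "-1 \<le> - min 5 (real s + 3) / (real s + 3)" by (simp add: field_simps)
        then have "real n powr (-1) \<le> real n powr (- min 5 (real s + 3) / (real s + 3))"
          using elim by (intro powr_mono) auto
        from mult_left_mono[OF this, of "4 * V"] show ?case
          using V unfolding T2 by (simp add: abs_mult)
      qed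
    qed
    ultimately have "(\<lambda>n. (m n - T2 f s n) + T2 f s n) \<in> O(?g)"
      by (rule sum_in_bigo)
    then show ?thesis by simp
  qed

  \<comment> \<open>The three regimes of \<open>s\<close>\<close>
  have case_large: "(\<lambda>n. m n / T1 f s Q1 Q2 n) \<longlonglongrightarrow> 1" if "s > 2"
  proof -
    have "5 / (real s + 3) < 1" using that by (simp add: field_simps)
    then have "(\<lambda>n. 4 * V / K * real n powr (5 / (real s + 3) - 1)) \<longlonglongrightarrow> 0"
      by (intro tendsto_mult_right_zero tendsto_neg_powr filterlim_real_sequentially) simp
    moreover have "5 / (real s + 3) - 1 = -1 - - 5 / (real s + 3)" by simp
    then have "real n powr (5 / (real s + 3) - 1) = real n powr (-1) / real n powr (- 5 / (real s + 3))" for n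
      by (simp only: powr_diff)
    ultimately have "(\<lambda>n. T2 f s n / T1 f s Q1 Q2 n) \<longlonglongrightarrow> 0"
      unfolding T1 T2 by (simp only: times_divide_times_eq)
    from tendsto_add[OF m_lim this] show ?thesis
      by (simp add: diff_divide_distrib)
  qed
  have case_0: "(\<lambda>n. m n / T2 f s n) \<longlonglongrightarrow> 1" if "s = 0"
  proof -
    \<comment> \<open>For \<open>s = 0\<close> the assumption \<open>psi_nonzero\<close> concerns
      \<open>psi f 2\<close> and excludes the constant density, for which \<open>T2\<close> would
      vanish.\<close>
    have "V > 0" using variance_pos psi_nonzero that by (simp add: V_def numeral_2_eq_2)
    have "(\<lambda>n. K / (4 * V) * real n powr (- 2 / 3)) \<longlonglongrightarrow> 0"
      by (intro tendsto_mult_right_zero tendsto_neg_powr filterlim_real_sequentially) simp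
    moreover have "- 2 / 3 = - 5 / (real s + 3) - (-1)" using that by simp
    then have "real n powr (- 2 / 3) = real n powr (- 5 / (real s + 3)) / real n powr (-1)" for n
      by (simp only: powr_diff)
    ultimately have "(\<lambda>n. T1 f s Q1 Q2 n / T2 f s n) \<longlonglongrightarrow> 0"
      unfolding T1 T2 by (simp only: times_divide_times_eq)
    \<comment> \<open>Rests on \<open>m / T2 = (m - T2) / T1 * (T1 / T2) + 1\<close>, where the
      product tends to \<open>1 * 0\<close>.\<close>
    from tendsto_add[OF tendsto_mult[OF m_lim this] tendsto_const[of 1]]
    have "(\<lambda>n. (m n - T2 f s n) / T1 f s Q1 Q2 n * (T1 f s Q1 Q2 n / T2 f s n) + 1) \<longlonglongrightarrow> 1"
      by simp
    then show ?thesis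
    proof (rule Lim_transform_eventually)
      show "eventually (\<lambda>n. (m n - T2 f s n) / T1 f s Q1 Q2 n * (T1 f s Q1 Q2 n / T2 f s n) + 1 = m n / T2 f s n)
          sequentially"
        using eventually_ge_at_top[of 1]
      proof eventually_elim
        case (elim n)
        have "T2 f s n > 0" using \<open>V > 0\<close> elim by (simp add: T2')
        with T1_pos[OF elim] show ?case by (simp add: field_simps)
      qed
    qed
  qed
  have case_2: "(\<lambda>n. m n / (T1 f s Q1 Q2 n + T2 f s n)) \<longlonglongrightarrow> 1" if "s = 2"
  proof -
    \<comment> \<open>At \<open>s = 2\<close> both exponents are \<open>-1\<close>, so the share
      \<open>T1 / (T1 + T2)\<close> is the constant \<open>K / (K + 4 * V)\<close>, and
      \<open>m / (T1 + T2) - 1\<close> is this share times the error in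
      \<open>m_lim\<close>.\<close>
    have "(\<lambda>n. ((m n - T2 f s n) / T1 f s Q1 Q2 n - 1) * (K / (K + 4 * V)) + 1) \<longlonglongrightarrow> (1 - 1) * (K / (K + 4 * V)) + 1"
      by (intro tendsto_intros m_lim)
    then have "(\<lambda>n. ((m n - T2 f s n) / T1 f s Q1 Q2 n - 1) * (K / (K + 4 * V)) + 1) \<longlonglongrightarrow> 1"
      by simp
    then show ?thesis
    proof (rule Lim_transform_eventually)
      show "eventually (\<lambda>n. ((m n - T2 f s n) / T1 f s Q1 Q2 n - 1) * (K / (K + 4 * V)) + 1 =
          m n / (T1 f s Q1 Q2 n + T2 f s n)) sequentially"
        using eventually_ge_at_top[of 1]
      proof eventually_elim
        case (elim n)
        have pos': "T1 f s Q1 Q2 n > 0" "T1 f s Q1 Q2 n + T2 f s n > 0"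
          using T1_pos[OF elim] V elim by (auto simp: T2' add_pos_nonneg)
        have "K / (K + 4 * V) = T1 f s Q1 Q2 n / (T1 f s Q1 Q2 n + T2 f s n)"
        proof -
          have "- 5 / (real s + 3) = -1" using that by simp
          then show ?thesis
            unfolding T1 T2 using elim by (simp only: distrib_right[symmetric]) simp
        qed
        moreover have "((m n - t2) / t1 - 1) * (t1 / (t1 + t2)) + 1 = m n / (t1 + t2)"
          if "t1 > 0" "t1 + t2 > 0" for t1 t2
        proof -
          have "(m n - t2) / t1 - 1 = (m n - (t1 + t2)) / t1"
            using that by (simp add: diff_divide_distrib add_divide_distrib)
          then have "((m n - t2) / t1 - 1) * (t1 / (t1 + t2)) = (m n - (t1 + t2)) / (t1 + t2)"
            using that by (simp only: times_divide_times_eq) simp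
          also have "\<dots> = m n / (t1 + t2) - 1"
            unfolding diff_divide_distrib using that by simp
          finally show ?thesis by simp
        qed
        ultimately show ?case using pos' by simp
      qed
    qed
  qed

  show ?thesis
    using ex asymp(1) bigo case_large case_0 case_2 by (auto simp: m_def[abs_def] h0_def)
qed

end
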